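(* Let $K\ge 1$ and consider the binary-symmetric parallel-relay (BSPR) network with $K$ relays and cross-over probabilities $p_{s,i},p_{i,d}\in[0,\tfrac12]$, $i=1,\dots,K$. Put $p_i=p_{s,i}(1-p_{i,d})+(1-p_{s,i})p_{i,d}$, and let $$p^*(y_i|u)=\begin{cases}1-p_i,& y_i=u,\\ p_i,&\text{otherwise,}\end{cases}\qquad u,y_i\in\{0,1\}.$$ For any distribution $p(u)$ on $\{0,1\}$, let $(U,Y_1,\dots,Y_K)$ have joint distribution $p(u)\prod_{i=1}^K p^*(y_i|u)$ and put $$R_{\mathrm F}=I(U;Y_1,Y_2,\dots,Y_K).$$ Then rates up to $R_{\mathrm F}$ are achievable in the network, i.e. every rate $R$ with $0\le R<R_{\mathrm F}$ is achievable.
   Context: **The BSPR network.** There is one source, $K$ relays $1,\dots,K$, and one destination. All channel inputs, outputs and noises are binary, and $\oplus$ is addition modulo 2. At each time $t=1,2,\dots$ the source transmits $U[t]\in\{0,1\}$ and relay $i$ receives $V_i[t]=U[t]\oplus Z_i[t]$ with $\Pr\{Z_i[t]=1\}=p_{s,i}$; relay $i$ transmits $X_i[t]\in\{0,1\}$ and the destination receives, on a separate link for each $i$, $Y_i[t]=X_i[t]\oplus E_i[t]$ with $\Pr\{E_i[t]=1\}=p_{i,d}$. Here $0\le p_{s,i},p_{i,d}\le \tfrac12$. All the noises $Z_i[t],E_i[t]$ (over all $i,t$) are independent of each other and of the message. **Codes and achievable rates.** A code of rate $R\ge 0$ and length $n$ has a message $W$ uniform on $\{0,1,\dots,\lceil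 2^{nR}\rceil-1\}$, a source encoder giving $(U[1],\dots,U[n])$ as a function of $W$, for each relay $i$ and time $t\le n$ a function giving $X_i[t]$ from $(V_i[1],\dots,V_i[t-1])$, and a decoder giving $\hat W$ from $(Y_i[t])_{1\le i\le K,\,1\le t\le n}$. Its error probability is $P_e=\Pr\{\hat W\ne W\}$. A rate $R$ is achievable if for every $\epsilon>0$ and all sufficiently large $n$ there is a code of rate $R$ and length $n$ with $P_e<\epsilon$. $I(\cdot\,;\cdot)$ is mutual information with logarithms to base 2; rates are in bits per channel use. *)

theory Defs
  imports "HOL-Probability.Probability"
begin

text \<open>
  Bits are rendered as booleans (1 is True), so addition modulo 2 is \<open>(\<noteq>)\<close>. The relays
  are the elements of a finite type \<open>'k\<close>, that is, \<open>K = CARD('k)\<close>; in particular \<open>K \<ge> 1\<close>.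
  Times are the natural numbers \<open>1, 2, \<dots>\<close>.
\<close>

text \<open>
  The list argument of \<open>relay_enc i t\<close> is \<open>[V\<^sub>i[1], \<dots>, V\<^sub>i[t - 1]]\<close>, and the argument of
  \<open>decoder\<close> maps each \<open>i\<close> to \<open>[Y\<^sub>i[1], \<dots>, Y\<^sub>i[n]]\<close>. The rate and the length of a code are not
  components of the record; they are parameters of its error probability.
\<close>

record 'k relay_code =
  source_enc :: "nat \<Rightarrow> nat \<Rightarrow> bool"
  relay_enc :: "'k \<Rightarrow> nat \<Rightarrow> bool list \<Rightarrow> bool"
  decoder :: "('k \<Rightarrow> bool list) \<Rightarrow> nat"

definition relay_received ::
    "'k relay_code \<Rightarrow> nat \<Rightarrow> ('k \<times> nat \<Rightarrow> bool) \<Rightarrow> 'k \<Rightarrow> nat \<Rightarrow> bool" where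
  "relay_received c w z i t = (source_enc c w t \<noteq> z (i, t))"

definition relay_sent ::
    "'k relay_code \<Rightarrow> nat \<Rightarrow> ('k \<times> nat \<Rightarrow> bool) \<Rightarrow> 'k \<Rightarrow> nat \<Rightarrow> bool" where
  "relay_sent c w z i t = relay_enc c i t (map (relay_received c w z i) [1..<t])"

definition dest_received ::
    "'k relay_code \<Rightarrow> nat \<Rightarrow> ('k \<times> nat \<Rightarrow> bool) \<Rightarrow> ('k \<times> nat \<Rightarrow> bool) \<Rightarrow> 'k \<Rightarrow> nat \<Rightarrow> bool" where
  "dest_received c w z e i t = (relay_sent c w z i t \<noteq> e (i, t))"

definition decoded ::
    "nat \<Rightarrow> 'k relay_code \<Rightarrow> nat \<Rightarrow> ('k \<times> nat \<Rightarrow> bool) \<Rightarrow> ('k \<times> nat \<Rightarrow> bool) \<Rightarrow> nat" where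
  "decoded n c w z e = decoder c (\<lambda>i. map (dest_received c w z e i) [1..<Suc n])"

definition num_messages :: "real \<Rightarrow> nat \<Rightarrow> nat" where
  "num_messages R n = nat \<lceil>2 powr (real n * R)\<rceil>"

text \<open>
  The noise bits of one hop, independent over all relays and all times \<open>1, \<dots>, n\<close>. Later
  noise bits do not influence a code of length \<open>n\<close>; \<open>Pi_pmf\<close> sets the coordinates outside its
  index set to the default value.
\<close>

definition noise_pmf :: "nat \<Rightarrow> ('k::finite \<Rightarrow> real) \<Rightarrow> ('k \<times> nat \<Rightarrow> bool) pmf" where
  "noise_pmf n q = Pi_pmf (UNIV \<times> {1..n}) False (\<lambda>(i, t). bernoulli_pmf (q i))"

definition network_pmf ::
    "('k::finite \<Rightarrow> real) \<Rightarrow> ('k \<Rightarrow> real) \<Rightarrow> real \<Rightarrow> nat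
      \<Rightarrow> (nat \<times> ('k \<times> nat \<Rightarrow> bool) \<times> ('k \<times> nat \<Rightarrow> bool)) pmf" where
  "network_pmf ps pd R n =
     pair_pmf (pmf_of_set {..<num_messages R n}) (pair_pmf (noise_pmf n ps) (noise_pmf n pd))"

definition error_prob ::
    "('k::finite \<Rightarrow> real) \<Rightarrow> ('k \<Rightarrow> real) \<Rightarrow> real \<Rightarrow> nat \<Rightarrow> 'k relay_code \<Rightarrow> real" where
  "error_prob ps pd R n c =
     measure_pmf.prob (network_pmf ps pd R n) {(w, z, e). decoded n c w z e \<noteq> w}"

definition achievable :: "('k::finite \<Rightarrow> real) \<Rightarrow> ('k \<Rightarrow> real) \<Rightarrow> real \<Rightarrow> bool" where
  "achievable ps pd R \<longleftrightarrow>
     0 \<le> R \<and> (\<forall>\<epsilon>>0. \<exists>N. \<forall>n\<ge>N. \<exists>c. error_prob ps pd R n c < \<epsilon>)"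

definition crossover :: "real \<Rightarrow> real \<Rightarrow> real" where
  "crossover a b = a * (1 - b) + (1 - a) * b"

definition bsc_pmf :: "real \<Rightarrow> bool \<Rightarrow> bool pmf" where
  "bsc_pmf p u = map_pmf (\<lambda>e. u \<noteq> e) (bernoulli_pmf p)"

lemma pmf_bsc_pmf:
  assumes "0 \<le> p" "p \<le> 1"
  shows "pmf (bsc_pmf p u) y = (if y = u then 1 - p else p)"
proof -
  have inj: "inj (\<lambda>e. u \<noteq> e)"
    by (auto simp: inj_def)
  have "pmf (bsc_pmf p u) y = pmf (bsc_pmf p u) (u \<noteq> (u \<noteq> y))"
    by (rule arg_cong[where f = "pmf (bsc_pmf p u)"]) auto
  also have "\<dots> = pmf (bernoulli_pmf p) (u \<noteq> y)"
    unfolding bsc_pmf_def by (rule pmf_map_inj'[OF inj])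
  finally show ?thesis
    using assms by (cases u; cases y) auto
qed

definition joint_pmf :: "bool pmf \<Rightarrow> ('k::finite \<Rightarrow> real) \<Rightarrow> (bool \<times> ('k \<Rightarrow> bool)) pmf" where
  "joint_pmf P p =
     bind_pmf P (\<lambda>u. map_pmf (Pair u) (Pi_pmf UNIV False (\<lambda>i. bsc_pmf (p i) u)))"

lemma pmf_joint_pmf:
  fixes p :: "'k::finite \<Rightarrow> real"
  shows "pmf (joint_pmf P p) (u, y) = pmf P u * (\<Prod>i\<in>UNIV. pmf (bsc_pmf (p i) u) (y i))"
proof -
  have "pmf (map_pmf (Pair v) (Pi_pmf UNIV False (\<lambda>i. bsc_pmf (p i) v))) (u, y) =
      (if v = u then \<Prod>i\<in>UNIV. pmf (bsc_pmf (p i) u) (y i) else 0)" for v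
  proof (cases "v = u")
    case True
    have "pmf (map_pmf (Pair u) (Pi_pmf UNIV False (\<lambda>i. bsc_pmf (p i) u))) (u, y) =
        pmf (Pi_pmf UNIV False (\<lambda>i. bsc_pmf (p i) u)) y"
      by (rule pmf_map_inj') (auto simp: inj_def)
    with True show ?thesis
      by (simp add: pmf_Pi)
  next
    case False
    then show ?thesis
      by (auto simp: pmf_eq_0_set_pmf)
  qed
  then show ?thesis
    unfolding joint_pmf_def pmf_bind
    by (cases u) (simp_all add: integral_measure_pmf_real[where A = UNIV] UNIV_bool)
qed

definition rate_F :: "('k::finite \<Rightarrow> real) \<Rightarrow> ('k \<Rightarrow> real) \<Rightarrow> bool pmf \<Rightarrow> real" where
  "rate_F ps pd P =
     prob_space.mutual_information (measure_pmf (joint_pmf P (\<lambda>i. crossover (ps i) (pd i)))) 2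
       (count_space UNIV) (count_space UNIV) fst snd"

end

theory Submission
  imports Defs
begin

text \<open>
  If every relay repeats the bit it received one step earlier, the network becomes the memoryless
  channel \<open>p\<^sup>*\<close>, used \<open>n - 1\<close> times. Its coding theorem follows from Feinstein's greedy
  construction: with the threshold \<open>\<tau> = 2\<^bsup>m \<gamma>\<^esup>\<close> for \<open>R < \<gamma> < R\<^sub>F\<close>, codewords are added
  as long as some input still has a large decoding set disjoint from the earlier ones, and failure
  before \<open>M\<close> words would force the information density to be at most \<open>m \<gamma>\<close> with probability
  larger than Hoeffding's inequality allows.
\<close>

section \<open>Mixtures and finite products of discrete distributions\<close>

lemma measure_bind_pmf:
  "measure_pmf.prob (bind_pmf p f) X = (\<integral>x. measure_pmf.prob (f x) X \<partial>measure_pmf p)"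
proof -
  have "ennreal (measure_pmf.prob (bind_pmf p f) X)
      = (\<integral>\<^sup>+x. ennreal (measure_pmf.prob (f x) X) \<partial>measure_pmf p)"
    by (simp add: measure_pmf.emeasure_eq_measure[symmetric])
  also have "\<dots> = ennreal (\<integral>x. measure_pmf.prob (f x) X \<partial>measure_pmf p)"
    by (intro nn_integral_eq_integral measure_pmf.integrable_const_bound[where B = 1]) auto
  finally show ?thesis
    by (subst (asm) ennreal_inj) auto
qed

lemma measure_bind_pmf_le:
  assumes "\<And>x. x \<in> set_pmf p \<Longrightarrow> measure_pmf.prob (f x) X \<le> \<delta>"
  shows "measure_pmf.prob (bind_pmf p f) X \<le> \<delta>"
  unfolding measure_bind_pmf
  by (intro measure_pmf.integral_le_const measure_pmf.integrable_const_bound[where B = 1])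
     (auto intro!: AE_pmfI assms)

text \<open>A map is a bind with point masses, and binds commute with finite products. Since
  \<open>f\<close> varies with the coordinate and nothing links \<open>f x d'\<close> to
  \<open>d\<close>, the conditional resets the coordinates outside \<open>A\<close>.\<close>

lemma Pi_pmf_map_dep:
  assumes "finite A"
  shows "Pi_pmf A d (\<lambda>x. map_pmf (f x) (p x)) =
    map_pmf (\<lambda>h x. if x \<in> A then f x (h x) else d) (Pi_pmf A d' p)"
proof -
  have "Pi_pmf A d (\<lambda>x. return_pmf (f x (h x)))
      = return_pmf (\<lambda>x. if x \<in> A then f x (h x) else d)" for h
    using assms by simp
  then show ?thesis
    unfolding map_pmf_def by (subst Pi_pmf_bind[OF assms, where d' = d']) simp
qed

text \<open>Injectivity keeps the selected coordinates distinct, hence independent, and all others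
  integrate to 1. This serves to discard noise bits and to shift time.\<close>

lemma Pi_pmf_reindex:
  assumes "finite B" "inj_on h A" "h ` A \<subseteq> B"
  shows "Pi_pmf A d (\<lambda>x. p (h x)) =
    map_pmf (\<lambda>f x. if x \<in> A then f (h x) else d) (Pi_pmf B d' p)" (is "_ = map_pmf ?F _")
proof (rule pmf_eqI)
  fix g
  have A: "finite A"
    using assms by (meson finite_imageD finite_subset)
  show "pmf (Pi_pmf A d (\<lambda>x. p (h x))) g = pmf (map_pmf ?F (Pi_pmf B d' p)) g"
  proof (cases "\<forall>x. x \<notin> A \<longrightarrow> g x = d")
    case True
    \<comment> \<open>The fibre of the map over \<open>g\<close> is a box: coordinates hit by
      \<open>h\<close> are prescribed, the others are free and contribute the factor 1.\<close>
    define C where "C y = (if y \<in> h ` A then {g (the_inv_into A h y)} else UNIV)" for y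
    have inv: "the_inv_into A h (h x) = x" if "x \<in> A" for x
      using assms(2) that by (rule the_inv_into_f_f)
    have "?F -` {g} = Pi B C"
    proof (intro set_eqI iffI)
      fix f assume f: "f \<in> ?F -` {g}"
      have "f (h x) = g x" if "x \<in> A" for x
        using f that by (auto dest: fun_cong[where x = x])
      then show "f \<in> Pi B C"
        by (auto simp: C_def inv)
    next
      fix f assume f: "f \<in> Pi B C"
      have "f (h x) = g x" if "x \<in> A" for x
      proof -
        have "h x \<in> B" using that assms(3) by auto
        with f have "f (h x) \<in> C (h x)" by auto
        with that show ?thesis by (auto simp: C_def inv)
      qed
      with True show "f \<in> ?F -` {g}" by auto
    qed
    then have "pmf (map_pmf ?F (Pi_pmf B d' p)) g = (\<Prod>y\<in>B. measure_pmf.prob (p y) (C y))"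
      using assms by (simp add: pmf_map measure_Pi_pmf_Pi)
    also have "\<dots> = (\<Prod>y\<in>h ` A. measure_pmf.prob (p y) (C y))"
      using assms by (intro prod.mono_neutral_right) (auto simp: C_def)
    also have "\<dots> = (\<Prod>x\<in>A. measure_pmf.prob (p (h x)) (C (h x)))"
      using assms by (simp add: prod.reindex)
    also have "\<dots> = (\<Prod>x\<in>A. pmf (p (h x)) (g x))"
      by (intro prod.cong) (auto simp: C_def inv measure_pmf_single)
    finally show ?thesis
      using A True by (simp add: pmf_Pi)
  next
    case False
    then have "?F -` {g} = {}"
      by auto
    moreover have "pmf (Pi_pmf A d (\<lambda>x. p (h x))) g = 0"
      using A False by (intro pmf_Pi_outside) auto
    ultimately show ?thesis
      by (simp add: pmf_map)
  qed
qed

text \<open>The input draws can be pulled out of the product, so generating input-output pairs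
  letter by letter agrees with drawing the input word first and then sending it through the product
  channel.\<close>

lemma Pi_pmf_joint:
  assumes "finite A"
  shows "map_pmf (\<lambda>h. (fst \<circ> h, snd \<circ> h))
      (Pi_pmf A (d, d') (\<lambda>t. bind_pmf (P t) (\<lambda>u. map_pmf (Pair u) (V t u)))) =
    bind_pmf (Pi_pmf A d P) (\<lambda>x. map_pmf (Pair x) (Pi_pmf A d' (\<lambda>t. V t (x t))))"
proof -
  have "map_pmf (\<lambda>h. (fst \<circ> h, snd \<circ> h)) (Pi_pmf A (d, d') (\<lambda>t. map_pmf (Pair (x t)) (V t (x t))))
      = map_pmf (Pair x) (Pi_pmf A d' (\<lambda>t. V t (x t)))" if "x \<in> set_pmf (Pi_pmf A d P)" for x
  proof -
    \<comment> \<open>On the support both words take their defaults outside \<open>A\<close>, which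
      matches the default pair \<open>(d, d')\<close>.\<close>
    have x: "t \<notin> A \<Longrightarrow> x t = d" for t
      using that set_Pi_pmf_subset[OF assms, of d P] by blast
    have "y \<in> set_pmf (Pi_pmf A d' (\<lambda>t. V t (x t))) \<Longrightarrow> t \<notin> A \<Longrightarrow> d' = y t" for y t
      using set_Pi_pmf_subset[OF assms, of d' "\<lambda>t. V t (x t)"] by blast
    with x show ?thesis
      by (subst Pi_pmf_map_dep[OF assms, where d' = d'])
         (auto simp: map_pmf_comp fun_eq_iff intro!: map_pmf_cong)
  qed
  then show ?thesis
    by (subst Pi_pmf_bind[OF assms, where d' = d]) (auto simp: map_bind_pmf intro!: bind_pmf_cong)
qed

lemma Pi_pmf_pair:
  assumes "finite A"
  shows "pair_pmf (Pi_pmf A d p) (Pi_pmf A d' q) =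
    map_pmf (\<lambda>h. (fst \<circ> h, snd \<circ> h)) (Pi_pmf A (d, d') (\<lambda>t. pair_pmf (p t) (q t)))"
  using Pi_pmf_joint[OF assms, of d d' p "\<lambda>t u. q t"]
  by (simp add: pair_pmf_def map_pmf_def)

text \<open>Currying is injective, so it suffices to compare point masses, which are the same double
  product over times and relays.\<close>

lemma Pi_pmf_curry:
  fixes p :: "'b \<Rightarrow> 'a::finite \<Rightarrow> 'c pmf"
  assumes "finite A"
  shows "Pi_pmf A (\<lambda>_. d) (\<lambda>t. Pi_pmf UNIV d (p t)) =
    map_pmf (\<lambda>g t i. g (i, t)) (Pi_pmf (UNIV \<times> A) d (\<lambda>(i, t). p t i))"
proof (rule pmf_eqI)
  fix y :: "'b \<Rightarrow> 'a \<Rightarrow> 'c"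
  have inj: "inj (\<lambda>(g :: 'a \<times> 'b \<Rightarrow> 'c) t i. g (i, t))"
    by (auto simp: inj_def fun_eq_iff)
  have "pmf (map_pmf (\<lambda>g t i. g (i, t)) (Pi_pmf (UNIV \<times> A) d (\<lambda>(i, t). p t i))) y
      = pmf (Pi_pmf (UNIV \<times> A) d (\<lambda>(i, t). p t i)) (\<lambda>(i, t). y t i)"
    using pmf_map_inj'[OF inj, of "Pi_pmf (UNIV \<times> A) d (\<lambda>(i, t). p t i)" "\<lambda>(i, t). y t i"] by simp
  also have "\<dots> = pmf (Pi_pmf A (\<lambda>_. d) (\<lambda>t. Pi_pmf UNIV d (p t))) y"
  proof -
    have "(\<Prod>x\<in>UNIV \<times> A. pmf (case x of (i, t) \<Rightarrow> p t i) (case x of (i, t) \<Rightarrow> y t i))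
        = (\<Prod>t\<in>A. \<Prod>i\<in>UNIV. pmf (p t i) (y t i))"
      by (subst prod.swap) (simp add: prod.cartesian_product split_def)
    with assms show ?thesis
      by (auto simp: pmf_Pi fun_eq_iff)
  qed
  finally show "pmf (Pi_pmf A (\<lambda>_. d) (\<lambda>t. Pi_pmf UNIV d (p t))) y =
      pmf (map_pmf (\<lambda>g t i. g (i, t)) (Pi_pmf (UNIV \<times> A) d (\<lambda>(i, t). p t i))) y" ..
qed

section \<open>Feinstein's maximal code construction\<close>

lemma measure_pmf_mono_pmf:
  assumes "0 \<le> \<tau>" "\<And>y. y \<in> D \<Longrightarrow> \<tau> * pmf q y \<le> pmf w y"
  shows "\<tau> * measure_pmf.prob q D \<le> measure_pmf.prob w D"
proof -
  have "ennreal (\<tau> * measure_pmf.prob q D) = ennreal \<tau> * (\<integral>\<^sup>+y. pmf q y \<partial>count_space D)"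
    using assms(1) by (simp add: nn_integral_pmf measure_pmf.emeasure_eq_measure ennreal_mult)
  also have "\<dots> = (\<integral>\<^sup>+y. ennreal (\<tau> * pmf q y) \<partial>count_space D)"
    using assms(1) by (simp add: nn_integral_cmult ennreal_mult)
  also have "\<dots> \<le> (\<integral>\<^sup>+y. pmf w y \<partial>count_space D)"
    by (intro nn_integral_mono ennreal_leI) (simp add: assms(2))
  also have "\<dots> = ennreal (measure_pmf.prob w D)"
    by (simp add: nn_integral_pmf measure_pmf.emeasure_eq_measure)
  finally show ?thesis
    by simp
qed

text \<open>A decoding set inside \<open>G x\<close> has output probability at most
  \<open>1 / \<tau>\<close>, so fewer than \<open>M\<close> of them cannot block every further
  input. Accordingly \<open>\<epsilon>\<close> adds the total \<open>M / \<tau>\<close> of these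
  bounds to the probability of a low density ratio.\<close>

lemma feinstein:
  fixes Q :: "'a pmf" and W :: "'a \<Rightarrow> 'b pmf" and \<tau> :: real and M :: nat
  assumes \<tau>: "0 < \<tau>"
  defines "\<epsilon> \<equiv> measure_pmf.prob (bind_pmf Q (\<lambda>x. map_pmf (Pair x) (W x)))
      {(x, y). pmf (W x) y \<le> \<tau> * pmf (bind_pmf Q W) y} + M / \<tau>"
  shows "\<exists>c D. disjoint_family_on D {..<M} \<and> (\<forall>j<M. 1 - \<epsilon> \<le> measure_pmf.prob (W (c j)) (D j))"
proof -
  define q where "q = bind_pmf Q W"
  define G where "G x = {y. \<tau> * pmf q y < pmf (W x) y}" for x
  \<comment> \<open>The inclusion in \<open>G (c j)\<close> strengthens the induction: it bounds the
    output mass of the sets chosen so far.\<close>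
  have "\<exists>c D. disjoint_family_on D {..<k} \<and>
      (\<forall>j<k. D j \<subseteq> G (c j) \<and> 1 - \<epsilon> \<le> measure_pmf.prob (W (c j)) (D j))" if "k \<le> M" for k
    using that
  proof (induction k)
    case 0
    then show ?case by (auto simp: disjoint_family_on_def)
  next
    case (Suc k)
    then obtain c D where disj: "disjoint_family_on D {..<k}"
      and DG: "\<And>j. j < k \<Longrightarrow> D j \<subseteq> G (c j)"
      and D: "\<And>j. j < k \<Longrightarrow> 1 - \<epsilon> \<le> measure_pmf.prob (W (c j)) (D j)"
      by auto
    define U where "U = (\<Union>j<k. D j)"
    have "measure_pmf.prob q (D j) \<le> 1 / \<tau>" if "j < k" for j
    proof -
      have "\<tau> * measure_pmf.prob q (D j) \<le> measure_pmf.prob (W (c j)) (D j)"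
        using DG[OF that] \<tau> by (intro measure_pmf_mono_pmf) (auto simp: G_def less_imp_le)
      also have "\<dots> \<le> 1" by simp
      finally show ?thesis using \<tau> by (simp add: field_simps)
    qed
    then have "(\<Sum>j<k. measure_pmf.prob q (D j)) \<le> (\<Sum>j<k. 1 / \<tau>)"
      by (intro sum_mono) simp
    moreover have "measure_pmf.prob q U \<le> (\<Sum>j<k. measure_pmf.prob q (D j))"
      unfolding U_def by (rule measure_pmf.finite_measure_subadditive_finite) auto
    ultimately have qU: "measure_pmf.prob q U \<le> k / \<tau>"
      by simp
    have "\<exists>x. 1 - \<epsilon> \<le> measure_pmf.prob (W x) (G x - U)"
    \<comment> \<open>If no input can be added, averaging \<open>G x\<close> over \<open>Q\<close>
      bounds the probability of a high density ratio by \<open>1 - \<epsilon> + k / \<tau>\<close>.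
      By the choice of \<open>\<epsilon>\<close> this gives
      \<open>M / \<tau> \<le> k / \<tau>\<close>, although \<open>k < M\<close>.\<close>
    proof (rule ccontr)
      assume "\<not> ?thesis"
      then have less: "measure_pmf.prob (W x) (G x - U) \<le> 1 - \<epsilon>" for x
        by (meson less_imp_le not_le)
      let ?J = "bind_pmf Q (\<lambda>x. map_pmf (Pair x) (W x))"
      let ?B = "{(x, y). pmf (W x) y \<le> \<tau> * pmf q y}"
      have vim: "Pair x -` (- ?B) = G x" for x
        by (auto simp: G_def)
      have int: "integrable (measure_pmf Q) (\<lambda>x. measure_pmf.prob (W x) (C x))" for C
        by (rule measure_pmf.integrable_const_bound[where B = 1]) auto
      have "1 - measure_pmf.prob ?J ?B = measure_pmf.prob ?J (- ?B)"
        using measure_pmf.prob_compl[of ?B ?J] by (simp add: Compl_eq_Diff_UNIV)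
      also have "\<dots> = (\<integral>x. measure_pmf.prob (W x) (G x) \<partial>measure_pmf Q)"
        unfolding measure_bind_pmf measure_map_pmf vim ..
      also have "\<dots> \<le> (\<integral>x. (1 - \<epsilon>) + measure_pmf.prob (W x) U \<partial>measure_pmf Q)"
      proof (intro integral_mono int Bochner_Integration.integrable_add)
        fix x
        have "measure_pmf.prob (W x) (G x) \<le> measure_pmf.prob (W x) ((G x - U) \<union> U)"
          by (rule measure_pmf.finite_measure_mono) auto
        also have "\<dots> \<le> measure_pmf.prob (W x) (G x - U) + measure_pmf.prob (W x) U"
          by (rule measure_Un_le) auto
        finally show "measure_pmf.prob (W x) (G x) \<le> (1 - \<epsilon>) + measure_pmf.prob (W x) U"
          using less[of x] by simp
      qed simp
      also have "\<dots> = (1 - \<epsilon>) + measure_pmf.prob q U"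
        using int by (subst Bochner_Integration.integral_add) (auto simp: q_def measure_bind_pmf)
      finally have "M / \<tau> \<le> k / \<tau>"
        using qU by (simp add: \<epsilon>_def q_def)
      then show False
        using \<tau> Suc.prems by (simp add: field_simps)
    qed
    then obtain x where x: "1 - \<epsilon> \<le> measure_pmf.prob (W x) (G x - U)" ..
    show ?case
    proof (intro exI conjI)
      show "disjoint_family_on (D(k := G x - U)) {..<Suc k}"
        using disj by (auto simp: disjoint_family_on_def U_def less_Suc_eq) blast+
      show "\<forall>j<Suc k. (D(k := G x - U)) j \<subseteq> G ((c(k := x)) j) \<and>
          1 - \<epsilon> \<le> measure_pmf.prob (W ((c(k := x)) j)) ((D(k := G x - U)) j)"
        using DG D x by (auto simp: less_Suc_eq)
    qed
  qed
  from this[of M] show ?thesis by auto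
qed

section \<open>Block coding for a finite memoryless channel\<close>

lemma hoeffding_Pi_pmf_le:
  fixes f :: "'a::finite \<Rightarrow> real"
  assumes "\<gamma> < measure_pmf.expectation p f"
  shows "\<exists>C>0. \<forall>m. measure_pmf.prob (Pi_pmf {1..m::nat} d (\<lambda>_. p)) {h. (\<Sum>t=1..m. f (h t)) \<le> m * \<gamma>}
    \<le> exp (- (C * m))"
proof -
  define \<mu> where "\<mu> = measure_pmf.expectation p f"
  \<comment> \<open>The added 1 keeps the interval from \<open>- b\<close> to \<open>b\<close>
    nondegenerate even if \<open>f\<close> vanishes.\<close>
  define b where "b = 1 + Max (range (\<lambda>x. \<bar>f x\<bar>))"
  have Max: "\<bar>f x\<bar> \<le> Max (range (\<lambda>x. \<bar>f x\<bar>))" for x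
    by (rule Max_ge) auto
  have fb: "\<bar>f x\<bar> \<le> b" for x
    using Max[of x] unfolding b_def by linarith
  have b: "0 < b"
    using Max[of undefined] unfolding b_def by linarith
  \<comment> \<open>Hoeffding's exponent for a deviation of \<open>m * (\<mu> - \<gamma>)\<close>
    and \<open>m\<close> intervals of width \<open>2 * b\<close>, divided by
    \<open>m\<close>.\<close>
  define C where "C = 2 * (\<mu> - \<gamma>)\<^sup>2 / (2 * b)\<^sup>2"
  have "measure_pmf.prob (Pi_pmf {1..m} d (\<lambda>_. p)) {h. (\<Sum>t=1..m. f (h t)) \<le> m * \<gamma>} \<le> exp (- (C * m))" for m :: nat
  \<comment> \<open>For \<open>m = 0\<close> the bound is 1; otherwise the squared widths have a
    positive sum, as Hoeffding's inequality requires.\<close>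
  proof (cases "m = 0")
    case False
    let ?M = "Pi_pmf {1..m} d (\<lambda>_. p)"
    interpret indep_interval_bounded_random_variables
      "measure_pmf ?M" "{1..m}" "\<lambda>t h. f (h t)" "\<lambda>_. - b" "\<lambda>_. b"
    proof
      show "prob_space.indep_vars (measure_pmf ?M) (\<lambda>_. borel) (\<lambda>t h. f (h t)) {1..m}"
        by (rule prob_space.indep_vars_compose2[OF _ indep_vars_Pi_pmf])
           (auto intro: measure_pmf.prob_space_axioms)
      show "AE h in measure_pmf ?M. f (h t) \<in> {- b..b}" for t
        using fb by (auto simp: abs_le_iff minus_le_iff)
    qed auto
    interpret H: Hoeffding_ineq "measure_pmf ?M" "{1..m}" "\<lambda>t h. f (h t)" "\<lambda>_. - b" "\<lambda>_. b"
      "\<Sum>t=1..m. measure_pmf.expectation ?M (\<lambda>h. f (h t))"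
      by unfold_locales
    have exp: "measure_pmf.expectation ?M (\<lambda>h. f (h t)) = \<mu>" if "t \<in> {1..m}" for t
    proof -
      have "measure_pmf.expectation ?M (\<lambda>h. f (h t)) = measure_pmf.expectation (map_pmf (\<lambda>h. h t) ?M) f"
        by simp
      also have "map_pmf (\<lambda>h. h t) ?M = p"
        using that by (subst Pi_pmf_component) auto
      finally show ?thesis by (simp add: \<mu>_def)
    qed
    have "measure_pmf.prob ?M {h \<in> space (measure_pmf ?M). (\<Sum>t=1..m. f (h t)) \<le>
        (\<Sum>t=1..m. measure_pmf.expectation ?M (\<lambda>h. f (h t))) - m * (\<mu> - \<gamma>)}
      \<le> exp (- 2 * (m * (\<mu> - \<gamma>))\<^sup>2 / (\<Sum>t=1..m. (b - - b)\<^sup>2))"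
      using assms b False by (intro H.Hoeffding_ineq_le) (auto simp: \<mu>_def)
    also have "(\<Sum>t=1..m. measure_pmf.expectation ?M (\<lambda>h. f (h t))) - m * (\<mu> - \<gamma>) = m * \<gamma>"
      using exp by (simp add: algebra_simps)
    also have "- 2 * (m * (\<mu> - \<gamma>))\<^sup>2 / (\<Sum>t=1..m. (b - - b)\<^sup>2) = - (C * m)"
      using b False by (simp add: C_def power_mult_distrib power2_eq_square)
    finally show ?thesis by simp
  qed simp
  moreover have "0 < C"
    using assms b by (simp add: C_def \<mu>_def)
  ultimately show ?thesis by blast
qed

text \<open>For i.i.d. inputs the information density of a block is a sum of i.i.d. letter densities
  with mean above \<open>\<gamma>\<close>. Hoeffding bounds its lower tail, with \<open>C\<close>
  independent of \<open>m\<close> and \<open>M\<close>, and Feinstein's construction turns this into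
  a code.\<close>

lemma dmc_achievability:
  fixes P :: "'a::finite pmf" and V :: "'a \<Rightarrow> 'b::finite pmf"
  defines "J \<equiv> bind_pmf P (\<lambda>u. map_pmf (Pair u) (V u))"
  assumes \<gamma>: "\<gamma> < measure_pmf.expectation J (\<lambda>(u, y). log 2 (pmf (V u) y / pmf (bind_pmf P V) y))"
  shows "\<exists>C>0. \<forall>m (M::nat). \<exists>c D. disjoint_family_on D {..<M} \<and>
    (\<forall>j<M. 1 - (exp (- (C * m)) + M / 2 powr (m * \<gamma>))
      \<le> measure_pmf.prob (Pi_pmf {1..m::nat} d' (\<lambda>t. V (c j t))) (D j))"
proof -
  define q where "q = bind_pmf P V"
  define i where "i = (\<lambda>(u, y). log 2 (pmf (V u) y / pmf q y))"
  obtain C where C: "C > 0"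
    and tail: "\<And>m. measure_pmf.prob (Pi_pmf {1..m::nat} (undefined, d') (\<lambda>_. J))
        {h. (\<Sum>t=1..m. i (h t)) \<le> m * \<gamma>} \<le> exp (- (C * m))"
    using hoeffding_Pi_pmf_le[of \<gamma> J i] \<gamma> unfolding i_def q_def by blast
  have q: "map_pmf snd J = q"
    by (simp add: J_def q_def map_bind_pmf map_pmf_comp)
  show ?thesis
  proof (intro exI[of _ C] conjI allI)
    show "C > 0" by fact
    fix m M :: nat
    define Q where "Q = Pi_pmf {1..m} undefined (\<lambda>_. P)"
    define W where "W x = Pi_pmf {1..m} d' (\<lambda>t. V (x t))" for x
    define JJ where "JJ = Pi_pmf {1..m} (undefined, d') (\<lambda>_. J)"
    define \<tau> where "\<tau> = 2 powr (m * \<gamma>)"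
    have joint: "bind_pmf Q (\<lambda>x. map_pmf (Pair x) (W x)) = map_pmf (\<lambda>h. (fst \<circ> h, snd \<circ> h)) JJ"
      unfolding Q_def W_def JJ_def J_def by (rule Pi_pmf_joint[symmetric]) simp
    \<comment> \<open>The block output under i.i.d. inputs is again i.i.d., so the density ratio of
      a block factorises over time.\<close>
    have "bind_pmf Q W = map_pmf snd (bind_pmf Q (\<lambda>x. map_pmf (Pair x) (W x)))"
      by (simp add: map_bind_pmf map_pmf_comp)
    also have "\<dots> = map_pmf (\<lambda>h. snd \<circ> h) JJ"
      unfolding joint by (simp add: map_pmf_comp)
    also have "\<dots> = Pi_pmf {1..m} d' (\<lambda>_. map_pmf snd J)"
      unfolding JJ_def by (rule Pi_pmf_map[symmetric]) auto
    finally have qq: "bind_pmf Q W = Pi_pmf {1..m} d' (\<lambda>_. q)"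
      by (simp add: q)
    let ?B = "{(x, y). pmf (W x) y \<le> \<tau> * pmf (bind_pmf Q W) y}"
    have "measure_pmf.prob (bind_pmf Q (\<lambda>x. map_pmf (Pair x) (W x))) ?B =
        measure_pmf.prob JJ {h. pmf (W (fst \<circ> h)) (snd \<circ> h) \<le> \<tau> * pmf (bind_pmf Q W) (snd \<circ> h)}"
      unfolding joint by (simp add: vimage_def)
    also have "\<dots> \<le> measure_pmf.prob JJ {h. (\<Sum>t=1..m. i (h t)) \<le> m * \<gamma>}"
    \<comment> \<open>The inclusion is shown on the support only: there all letter probabilities are
      positive, so logarithms turn products into sums, and times outside the block carry the default
      \<open>d'\<close>.\<close>
    proof (rule measure_pmf.finite_measure_mono_AE)
      show "AE h in measure_pmf JJ.
          h \<in> {h. pmf (W (fst \<circ> h)) (snd \<circ> h) \<le> \<tau> * pmf (bind_pmf Q W) (snd \<circ> h)} \<longrightarrow>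
          h \<in> {h. (\<Sum>t=1..m. i (h t)) \<le> m * \<gamma>}"
      proof (rule AE_pmfI, safe)
        fix h assume h: "h \<in> set_pmf JJ"
        define w where "w t = pmf (V (fst (h t))) (snd (h t))" for t
        define r where "r t = pmf q (snd (h t))" for t
        have hJ: "h t \<in> set_pmf J" if "t \<in> {1..m}" for t
          using h that by (auto simp: JJ_def set_Pi_pmf PiE_dflt_def)
        have pos: "0 < w t" "0 < r t" if "t \<in> {1..m}" for t
        proof -
          from hJ[OF that] show "0 < w t"
            by (auto simp: J_def w_def pmf_positive)
          from hJ[OF that] have "snd (h t) \<in> set_pmf q"
            by (auto simp flip: q)
          then show "0 < r t" by (simp add: r_def pmf_positive)
        qed
        have d: "snd (h t) = d'" if "t \<notin> {1..m}" for t
          using h that by (auto simp: JJ_def set_Pi_pmf PiE_dflt_def)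
        assume "pmf (W (fst \<circ> h)) (snd \<circ> h) \<le> \<tau> * pmf (bind_pmf Q W) (snd \<circ> h)"
        moreover have "pmf (W (fst \<circ> h)) (snd \<circ> h) = (\<Prod>t=1..m. w t)"
          unfolding W_def using d by (subst pmf_Pi') (auto simp: w_def)
        moreover have "pmf (bind_pmf Q W) (snd \<circ> h) = (\<Prod>t=1..m. r t)"
          unfolding qq using d by (subst pmf_Pi') (auto simp: r_def)
        ultimately have "(\<Prod>t=1..m. w t) \<le> \<tau> * (\<Prod>t=1..m. r t)"
          by simp
        moreover have "0 < (\<Prod>t=1..m. r t)"
          using pos by (intro prod_pos) auto
        ultimately have le: "(\<Prod>t=1..m. w t / r t) \<le> \<tau>"
          by (simp add: prod_dividef field_simps)
        have "0 < (\<Prod>t=1..m. w t / r t)"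
          using pos by (intro prod_pos) auto
        with le have "log 2 (\<Prod>t=1..m. w t / r t) \<le> log 2 \<tau>"
          by (subst log_le_cancel_iff) (auto simp: \<tau>_def)
        also have "\<dots> = m * \<gamma>"
          by (simp add: \<tau>_def)
        also have "log 2 (\<Prod>t=1..m. w t / r t) = (\<Sum>t=1..m. log 2 (w t / r t))"
          using pos by (subst log_def, subst ln_prod) (force simp: log_def sum_divide_distrib)+
        also have "\<dots> = (\<Sum>t=1..m. i (h t))"
          by (intro sum.cong) (auto simp: i_def w_def r_def split_def)
        finally show "(\<Sum>t=1..m. i (h t)) \<le> m * \<gamma>" .
      qed
    qed auto
    also have "\<dots> \<le> exp (- (C * m))"
      unfolding JJ_def by (rule tail)
    finally have bad: "measure_pmf.prob (bind_pmf Q (\<lambda>x. map_pmf (Pair x) (W x))) ?B \<le> exp (- (C * m))" .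
    have "0 < \<tau>" by (simp add: \<tau>_def)
    from feinstein[OF this, of M Q W] obtain c D where "disjoint_family_on D {..<M}"
      and cD: "\<forall>j<M. 1 - (measure_pmf.prob (bind_pmf Q (\<lambda>x. map_pmf (Pair x) (W x))) ?B + M / \<tau>)
         \<le> measure_pmf.prob (W (c j)) (D j)"
      by blast
    moreover have "1 - (exp (- (C * m)) + M / \<tau>) \<le> measure_pmf.prob (W (c j)) (D j)" if "j < M" for j
      using cD[rule_format, OF that] bad by linarith
    ultimately show "\<exists>c D. disjoint_family_on D {..<M} \<and>
        (\<forall>j<M. 1 - (exp (- (C * m)) + M / 2 powr (m * \<gamma>))
          \<le> measure_pmf.prob (Pi_pmf {1..m} d' (\<lambda>t. V (c j t))) (D j))"
      unfolding W_def \<tau>_def by blast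
  qed
qed

text \<open>The factor \<open>pmf P u\<close> cancels in the ratio of joint to product distribution,
  which leaves the expected information density bounded below in
  \<open>dmc_achievability\<close>.\<close>

lemma mutual_information_joint:
  fixes P :: "'a::finite pmf" and V :: "'a \<Rightarrow> 'b::finite pmf"
  defines "J \<equiv> bind_pmf P (\<lambda>u. map_pmf (Pair u) (V u))"
  shows "prob_space.mutual_information (measure_pmf J) 2 (count_space UNIV) (count_space UNIV) fst snd =
    measure_pmf.expectation J (\<lambda>(u, y). log 2 (pmf (V u) y / pmf (bind_pmf P V) y))"
proof -
  interpret information_space "measure_pmf J" 2
    by unfold_locales simp
  have sd: "simple_distributed (measure_pmf J) f (pmf (map_pmf f J))" for f :: "'a \<times> 'b \<Rightarrow> 'c::finite"
    by (rule prob_space.simple_distributedI[OF measure_pmf.prob_space_axioms]) (auto simp: simple_function_def pmf_map)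
  have P: "map_pmf fst J = P"
    by (simp add: J_def map_bind_pmf map_pmf_comp bind_return_pmf')
  have q: "map_pmf snd J = bind_pmf P V"
    by (simp add: J_def map_bind_pmf map_pmf_comp)
  have J: "pmf J (u, y) = pmf P u * pmf (V u) y" for u y
  proof -
    have "pmf (map_pmf (Pair v) (V v)) (u, y) = indicator {u} v * pmf (V u) y" for v
      by (cases "v = u") (auto simp: pmf_map_inj' inj_def pmf_eq_0_set_pmf)
    then show ?thesis
      by (simp add: J_def pmf_bind measure_pmf_single)
  qed
  have "prob_space.mutual_information (measure_pmf J) 2 (count_space UNIV) (count_space UNIV) fst snd =
      (\<Sum>(u, y)\<in>UNIV. pmf J (u, y) * log 2 (pmf J (u, y) / (pmf P u * pmf (bind_pmf P V) y)))"
    using mutual_information_simple_distributed[OF sd[of fst] sd[of snd] sd[of "\<lambda>x. (fst x, snd x)"]]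
    by (simp add: P q)
  \<comment> \<open>Where \<open>pmf P u = 0\<close> nothing can be cancelled, but the weight
    \<open>pmf J (u, y)\<close> vanishes as well.\<close>
  also have "\<dots> = (\<Sum>(u, y)\<in>UNIV. pmf J (u, y) * log 2 (pmf (V u) y / pmf (bind_pmf P V) y))"
    by (intro sum.cong) (auto simp: J)
  also have "\<dots> = measure_pmf.expectation J (\<lambda>(u, y). log 2 (pmf (V u) y / pmf (bind_pmf P V) y))"
    by (subst integral_measure_pmf_real[where A = UNIV]) (auto simp: split_def mult.commute)
  finally show ?thesis .
qed

section \<open>Reduction of the relay network to a memoryless channel\<close>

lemma map_pmf_xor_bernoulli:
  assumes "0 \<le> a" "a \<le> 1" "0 \<le> b" "b \<le> 1"
  shows "map_pmf (\<lambda>(z, e). (u \<noteq> z) \<noteq> e) (pair_pmf (bernoulli_pmf a) (bernoulli_pmf b)) =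
    bsc_pmf (crossover a b) u"
proof (rule pmf_eqI)
  fix y
  \<comment> \<open>The crossover probability is a convex combination of \<open>1 - b\<close> and
    \<open>b\<close> with weights \<open>a\<close> and \<open>1 - a\<close>.\<close>
  have cr: "0 \<le> crossover a b" "crossover a b \<le> 1"
    using assms convex_bound_le[of "1 - b" 1 b a "1 - a"] by (auto simp: crossover_def)
  show "pmf (map_pmf (\<lambda>(z, e). (u \<noteq> z) \<noteq> e) (pair_pmf (bernoulli_pmf a) (bernoulli_pmf b))) y =
      pmf (bsc_pmf (crossover a b) u) y"
    using assms
    by (simp add: pmf_bsc_pmf[OF cr] map_pmf_def pair_pmf_def bind_assoc_pmf bind_return_pmf pmf_bind)
       (auto simp: crossover_def algebra_simps)
qed

text \<open>A bit sent at time \<open>t\<close> meets first-hop noise at \<open>t\<close> and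
  second-hop noise at \<open>Suc t\<close>. Different \<open>t\<close> use disjoint sets of noise
  bits, so the cascade is memoryless; the delay is why \<open>Suc m\<close> network uses carry
  \<open>m\<close> letters.\<close>

lemma effective_channel:
  fixes ps pd :: "'k::finite \<Rightarrow> real"
  assumes "\<And>i. 0 \<le> ps i" "\<And>i. ps i \<le> 1" "\<And>i. 0 \<le> pd i" "\<And>i. pd i \<le> 1"
  shows "map_pmf (\<lambda>(z, e) t. if t \<in> {1..m} then (\<lambda>i. (x t \<noteq> z (i, t)) \<noteq> e (i, Suc t)) else (\<lambda>_. False))
      (pair_pmf (noise_pmf (Suc m) ps) (noise_pmf (Suc m) pd)) =
    Pi_pmf {1..m} (\<lambda>_. False) (\<lambda>t. Pi_pmf UNIV False (\<lambda>i. bsc_pmf (crossover (ps i) (pd i)) (x t)))"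
    (is "?lhs = ?rhs")
proof -
  let ?A = "(UNIV :: 'k set) \<times> {1..m}"
  let ?N = "\<lambda>q. Pi_pmf ?A False (\<lambda>(i, t). bernoulli_pmf (q i))"
  let ?f = "\<lambda>z x. if x \<in> ?A then z x else False"
  \<comment> \<open>The relay delay is absorbed by shifting the second-hop noise one step back,
    which aligns it with the first hop.\<close>
  let ?g = "\<lambda>e x. if x \<in> ?A then e (fst x, Suc (snd x)) else False"
  have z: "map_pmf ?f (noise_pmf (Suc m) ps) = ?N ps"
    unfolding noise_pmf_def
    by (rule Pi_pmf_reindex[where h = "\<lambda>x. x", symmetric]) auto
  have e: "map_pmf ?g (noise_pmf (Suc m) pd) = ?N pd"
  proof -
    have "Pi_pmf ?A False (\<lambda>x. case (fst x, Suc (snd x)) of (i, t) \<Rightarrow> bernoulli_pmf (pd i)) =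
        map_pmf ?g (noise_pmf (Suc m) pd)"
      unfolding noise_pmf_def by (rule Pi_pmf_reindex) (auto simp: inj_on_def)
    then show ?thesis by (simp add: split_def)
  qed
  have "?rhs = map_pmf (\<lambda>g t i. g (i, t))
      (Pi_pmf ?A False (\<lambda>(i, t). bsc_pmf (crossover (ps i) (pd i)) (x t)))"
    by (rule Pi_pmf_curry) simp
  \<comment> \<open>Each cascaded channel is written as a function of one pair of noise bits, so
    that the function can leave the product and the pairs can be split by hop.\<close>
  also have "(\<lambda>(i, t). bsc_pmf (crossover (ps i) (pd i)) (x t)) =
      (\<lambda>p. map_pmf (\<lambda>(z, e). (x (snd p) \<noteq> z) \<noteq> e)
        (pair_pmf (case p of (i, t) \<Rightarrow> bernoulli_pmf (ps i)) (case p of (i, t) \<Rightarrow> bernoulli_pmf (pd i))))"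
  proof (rule ext)
    fix p :: "'k \<times> nat"
    show "(case p of (i, t) \<Rightarrow> bsc_pmf (crossover (ps i) (pd i)) (x t)) =
        map_pmf (\<lambda>(z, e). (x (snd p) \<noteq> z) \<noteq> e)
          (pair_pmf (case p of (i, t) \<Rightarrow> bernoulli_pmf (ps i)) (case p of (i, t) \<Rightarrow> bernoulli_pmf (pd i)))"
      by (cases p) (simp only: prod.case snd_conv map_pmf_xor_bernoulli[OF assms])
  qed
  also have "Pi_pmf ?A False \<dots> = map_pmf
      (\<lambda>h p. if p \<in> ?A then (case h p of (z, e) \<Rightarrow> (x (snd p) \<noteq> z) \<noteq> e) else False)
      (Pi_pmf ?A (False, False) (\<lambda>p.
        pair_pmf (case p of (i, t) \<Rightarrow> bernoulli_pmf (ps i)) (case p of (i, t) \<Rightarrow> bernoulli_pmf (pd i))))"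
    by (rule Pi_pmf_map_dep) simp
  also have "\<dots> = map_pmf (\<lambda>(z, e) p. if p \<in> ?A then (x (snd p) \<noteq> z p) \<noteq> e p else False)
      (pair_pmf (?N ps) (?N pd))"
    by (subst Pi_pmf_pair) (auto simp: map_pmf_comp split_def intro!: map_pmf_cong)
  also have "pair_pmf (?N ps) (?N pd) = map_pmf (\<lambda>(z, e). (?f z, ?g e))
      (pair_pmf (noise_pmf (Suc m) ps) (noise_pmf (Suc m) pd))"
    by (simp only: map_pair z e)
  finally show ?thesis
    by (auto simp: map_pmf_comp fun_eq_iff intro!: map_pmf_cong)
qed

text \<open>
  Lists are indexed from 0, so \<open>ys i ! t\<close> is \<open>Y\<^sub>i[t + 1]\<close>, which carries the bit sent at time \<open>t\<close>.
\<close>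

definition forwarding_code ::
    "nat \<Rightarrow> nat \<Rightarrow> (nat \<Rightarrow> nat \<Rightarrow> bool) \<Rightarrow> (nat \<Rightarrow> (nat \<Rightarrow> 'k \<Rightarrow> bool) set) \<Rightarrow> 'k relay_code" where
  "forwarding_code m M c D = \<lparr>
     source_enc = c,
     relay_enc = (\<lambda>i t vs. vs \<noteq> [] \<and> last vs),
     decoder = (\<lambda>ys. SOME w. w < M \<and>
       (\<lambda>t. if t \<in> {1..m} then (\<lambda>i. ys i ! t) else (\<lambda>_. False)) \<in> D w)\<rparr>"

text \<open>Disjoint decoding sets leave \<open>w\<close> as the only candidate for
  \<open>SOME\<close>, once the effective output lies in \<open>D w\<close>.\<close>

lemma decoded_forwarding_code:
  assumes "disjoint_family_on D {..<M}" "w < M"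
    and "(\<lambda>t. if t \<in> {1..m} then (\<lambda>i. (c w t \<noteq> z (i, t)) \<noteq> e (i, Suc t)) else (\<lambda>_. False)) \<in> D w"
  shows "decoded (Suc m) (forwarding_code m M c D) w z e = w"
proof -
  let ?c = "forwarding_code m M c D"
  \<comment> \<open>At time \<open>Suc t\<close> the relay has a nonempty list whose last entry was
    received at time \<open>t\<close>.\<close>
  have "relay_sent ?c w z i (Suc t) = (c w t \<noteq> z (i, t))" if "1 \<le> t" for i t
    using that by (simp add: relay_sent_def forwarding_code_def relay_received_def)
  then have "map (dest_received ?c w z e i) [1..<Suc (Suc m)] ! t = ((c w t \<noteq> z (i, t)) \<noteq> e (i, Suc t))"
    if "t \<in> {1..m}" for i t
    using that by (simp add: dest_received_def del: upt_Suc)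
  then have "(\<lambda>t. if t \<in> {1..m} then (\<lambda>i. map (dest_received ?c w z e i) [1..<Suc (Suc m)] ! t) else (\<lambda>_. False)) =
      (\<lambda>t. if t \<in> {1..m} then (\<lambda>i. (c w t \<noteq> z (i, t)) \<noteq> e (i, Suc t)) else (\<lambda>_. False))"
    by (auto simp: fun_eq_iff simp del: upt_Suc)
  moreover have "decoded (Suc m) ?c w z e = (SOME v. v < M \<and>
      (\<lambda>t. if t \<in> {1..m} then (\<lambda>i. map (dest_received ?c w z e i) [1..<Suc (Suc m)] ! t)
        else (\<lambda>_. False)) \<in> D v)"
    unfolding decoded_def by (subst (1) forwarding_code_def) (simp only: relay_code.simps)
  ultimately have "decoded (Suc m) ?c w z e = (SOME v. v < M \<and>
      (\<lambda>t. if t \<in> {1..m} then (\<lambda>i. (c w t \<noteq> z (i, t)) \<noteq> e (i, Suc t)) else (\<lambda>_. False)) \<in> D v)"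
    by simp
  also have "\<dots> = w"
    using assms by (intro some_equality) (auto simp: disjoint_family_on_def)
  finally show ?thesis .
qed

text \<open>Given the message \<open>w\<close>, an error forces the effective output outside
  \<open>D w\<close>. The bound \<open>\<delta>\<close> holds for each message, hence also for their
  average.\<close>

lemma error_prob_forwarding_code_le:
  fixes ps pd :: "'k::finite \<Rightarrow> real"
  assumes "\<And>i. 0 \<le> ps i" "\<And>i. ps i \<le> 1" "\<And>i. 0 \<le> pd i" "\<And>i. pd i \<le> 1"
    and "num_messages R (Suc m) = M" "0 < M" "disjoint_family_on D {..<M}"
    and "\<And>w. w < M \<Longrightarrow> 1 - \<delta> \<le> measure_pmf.prob (Pi_pmf {1..m} (\<lambda>_. False)
      (\<lambda>t. Pi_pmf UNIV False (\<lambda>i. bsc_pmf (crossover (ps i) (pd i)) (c w t)))) (D w)"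
  shows "error_prob ps pd R (Suc m) (forwarding_code m M c D) \<le> \<delta>"
proof -
  let ?N = "pair_pmf (noise_pmf (Suc m) ps) (noise_pmf (Suc m) pd)"
  let ?E = "{(w, z, e). decoded (Suc m) (forwarding_code m M c D) w z e \<noteq> w}"
  have net: "network_pmf ps pd R (Suc m) = bind_pmf (pmf_of_set {..<M}) (\<lambda>w. map_pmf (Pair w) ?N)"
    using assms(5) by (simp add: network_pmf_def pair_pmf_def map_pmf_def)
  have "measure_pmf.prob (map_pmf (Pair w) ?N) ?E \<le> \<delta>" if "w < M" for w
  proof -
    let ?y = "\<lambda>(z, e) t. if t \<in> {1..m} then (\<lambda>i. (c w t \<noteq> z (i, t)) \<noteq> e (i, Suc t)) else (\<lambda>_. False)"
    have "measure_pmf.prob (map_pmf (Pair w) ?N) ?E \<le> measure_pmf.prob (map_pmf ?y ?N) (- D w)"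
      unfolding measure_map_pmf
      using decoded_forwarding_code[OF assms(7) that]
      by (intro measure_pmf.finite_measure_mono) auto
    also have "\<dots> = 1 - measure_pmf.prob (map_pmf ?y ?N) (D w)"
      using measure_pmf.prob_compl[of "D w" "map_pmf ?y ?N"] by (simp add: Compl_eq_Diff_UNIV)
    also have "\<dots> \<le> \<delta>"
      using assms(8)[OF that] unfolding effective_channel[OF assms(1-4)] by linarith
    finally show ?thesis .
  qed
  then show ?thesis
    unfolding error_prob_def net using assms(6)
    by (intro measure_bind_pmf_le) (auto simp: set_pmf_of_set lessThan_empty_iff)
qed

section \<open>Choice of the threshold rate and decay of the error bound\<close>

theorem theorem3:
  fixes ps pd :: "'k::finite \<Rightarrow> real" and P :: "bool pmf" and R :: real
  assumes "\<And>i. 0 \<le> ps i" and "\<And>i. ps i \<le> 1 / 2"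
    and "\<And>i. 0 \<le> pd i" and "\<And>i. pd i \<le> 1 / 2"
    and "0 \<le> R" and "R < rate_F ps pd P"
  shows "achievable ps pd R"
proof -
  define V where "V u = Pi_pmf UNIV False (\<lambda>i. bsc_pmf (crossover (ps i) (pd i)) u)" for u
  have le1: "ps i \<le> 1" "pd i \<le> 1" for i
    using assms(2,4)[of i] by linarith+
  \<comment> \<open>The gap below \<open>rate_F\<close> drives the Hoeffding bound; the gap above
    \<open>R\<close> makes the number of messages small against the threshold.\<close>
  obtain \<gamma> where \<gamma>: "R < \<gamma>" "\<gamma> < rate_F ps pd P"
    using assms(6) dense by blast
  then have "\<gamma> < measure_pmf.expectation (bind_pmf P (\<lambda>u. map_pmf (Pair u) (V u)))
      (\<lambda>(u, y). log 2 (pmf (V u) y / pmf (bind_pmf P V) y))"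
    by (simp add: rate_F_def joint_pmf_def V_def[symmetric] mutual_information_joint)
  from dmc_achievability[OF this, of "\<lambda>_. False"] obtain C where "0 < C" and
    code: "\<And>m (M::nat). \<exists>c D. disjoint_family_on D {..<M} \<and>
      (\<forall>j<M. 1 - (exp (- (C * m)) + M / 2 powr (m * \<gamma>))
        \<le> measure_pmf.prob (Pi_pmf {1..m::nat} (\<lambda>_. False) (\<lambda>t. V (c j t))) (D j))"
    by blast
  define \<delta> where "\<delta> m = exp (- (C * m)) + num_messages R (Suc m) / 2 powr (m * \<gamma>)" for m :: nat
  \<comment> \<open>A geometric majorant of \<open>\<delta>\<close>: the factor
    \<open>2 powr R\<close> pays for the extra time slot, and the last term comes from rounding the
    number of messages up.\<close>
  define B where "B m = exp (- C) ^ m + (2 powr R * (2 powr (R - \<gamma>)) ^ m + (2 powr - \<gamma>) ^ m)" for m :: nat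
  have \<delta>B: "\<delta> m \<le> B m" for m
  proof -
    have "num_messages R (Suc m) \<le> 2 powr (Suc m * R) + 1"
      unfolding num_messages_def by (simp add: of_nat_nat)
    then have "num_messages R (Suc m) / 2 powr (m * \<gamma>) \<le> (2 powr (Suc m * R) + 1) / 2 powr (m * \<gamma>)"
      by (intro divide_right_mono) auto
    also have "\<dots> = 2 powr R * (2 powr (R - \<gamma>)) ^ m + (2 powr - \<gamma>) ^ m"
      by (simp add: powr_realpow[symmetric] powr_powr add_divide_distrib powr_diff[symmetric]
          powr_add[symmetric] powr_minus_divide[symmetric] algebra_simps)
    finally show ?thesis
      by (simp add: \<delta>_def B_def exp_of_nat_mult[symmetric] mult.commute)
  qed
  \<comment> \<open>All three ratios are below 1; for \<open>2 powr - \<gamma>\<close> this holds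
    because \<open>\<gamma> > R \<ge> 0\<close>.\<close>
  have "B \<longlonglongrightarrow> 0 + (2 powr R * 0 + 0)"
    unfolding B_def using \<open>0 < C\<close> \<gamma> assms(5)
    by (intro tendsto_intros LIMSEQ_power_zero) (auto simp: powr_less_one)
  then have B0: "B \<longlonglongrightarrow> 0" by simp
  have "\<exists>N. \<forall>n\<ge>N. \<exists>c. error_prob ps pd R n c < \<epsilon>" if "0 < \<epsilon>" for \<epsilon>
  proof -
    obtain N where N: "\<And>m. m \<ge> N \<Longrightarrow> B m < \<epsilon>"
      using order_tendstoD(2)[OF B0 \<open>0 < \<epsilon>\<close>] by (auto simp: eventually_sequentially)
    have "\<exists>c. error_prob ps pd R n c < \<epsilon>" if n: "n \<ge> Suc N" for n
    proof -
      obtain m where m: "n = Suc m" "m \<ge> N"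
        using n by (cases n) auto
      let ?M = "num_messages R (Suc m)"
      obtain c D where "disjoint_family_on D {..<?M}"
        and "\<And>j. j < ?M \<Longrightarrow> 1 - \<delta> m
          \<le> measure_pmf.prob (Pi_pmf {1..m} (\<lambda>_. False) (\<lambda>t. V (c j t))) (D j)"
        using code[of ?M m] unfolding \<delta>_def by blast
      moreover have "0 < ?M"
        by (simp add: num_messages_def)
      ultimately have "error_prob ps pd R (Suc m) (forwarding_code m ?M c D) \<le> \<delta> m"
        unfolding V_def using assms(1,3) le1 by (intro error_prob_forwarding_code_le) auto
      also have "\<dots> < \<epsilon>"
        using \<delta>B[of m] N[OF m(2)] by simp
      finally show ?thesis
        unfolding m(1) by blast
    qed
    then show ?thesis by blast
  qed
  with assms(5) show ?thesis
    unfolding achievable_def by blast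
qed

end
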